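(* Let $r,s,t$ be nonnegative integers with $r+s+t=N$ and let $\rho,\sigma,\tau$ be nonnegative integers with $\rho+\sigma+\tau=N$. Then $$\langle x^r y^s z^t,\ \tilde x^\rho \tilde y^\sigma \tilde z^\tau\rangle = N!\,\nu^N\, P(s,t,\sigma,\tau).$$
   Context: Let $p_1,p_2,p_3,p_4\in\mathbb C$ be such that all of $p_1,\ p_2,\ p_3,\ p_4,\ p_1+p_2,\ p_1+p_3,\ p_2+p_4,\ p_3+p_4,\ p_1+p_2+p_3+p_4,\ p_1p_4-p_2p_3$ are nonzero, and let $N\ge 0$ be an integer. Put $S=p_1+p_2+p_3+p_4$ and $$\mathbf t=\tfrac{(p_1+p_2)(p_1+p_3)}{p_1S},\quad \mathbf u=\tfrac{(p_1+p_3)(p_3+p_4)}{p_3S},\quad \mathbf v=\tfrac{(p_1+p_2)(p_2+p_4)}{p_2S},\quad \mathbf w=\tfrac{(p_2+p_4)(p_3+p_4)}{p_4S}.$$ With $(\alpha)_n=\alpha(\alpha+1)\cdots(\alpha+n-1)$, define the polynomial $$P(a,b,c,d)=\sum_{\substack{i,j,k,\ell\ge 0\\ i+j+k+\ell\le N}}\frac{(-a)_{i+j}(-b)_{k+\ell}(-c)_{i+k}(-d)_{j+\ell}}{i!\,j!\,k!\,\ell!\,(-N)_{i+j+k+\ell}}\,\mathbf t^i\mathbf u^j\mathbf v^k\mathbf w^\ell .$$ Put $$\nu=\tfrac{(p_1+p_2)(p_1+p_3)(p_2+p_4)(p_3+p_4)}{(p_1p_4-p_2p_3)^2},\qquad \tilde\eta_0=\nu^{-1},\quad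 \tilde\eta_1=\tfrac{p_1p_3S}{(p_1+p_2)(p_1+p_3)(p_3+p_4)},\quad \tilde\eta_2=\tfrac{p_2p_4S}{(p_1+p_2)(p_2+p_4)(p_3+p_4)},$$ $$\vartheta=\tfrac{(p_1+p_3)(p_2+p_4)}{p_2p_3-p_1p_4},\qquad \tilde\vartheta=\tfrac{(p_1+p_2)(p_3+p_4)}{p_2p_3-p_1p_4}.$$ Let $x,y,z$ be commuting indeterminates, and let $V$ be the space of homogeneous polynomials of total degree $N$ in $\mathbb C[x,y,z]$. Define $$\tilde x=\tilde\vartheta(\tilde\eta_0x+\tilde\eta_1y+\tilde\eta_2z),\quad \tilde y=\tilde\vartheta\big(\tilde\eta_0x+(1-\mathbf t)\tilde\eta_1y+(1-\mathbf v)\tilde\eta_2z\big),\quad \tilde z=\tilde\vartheta\big(\tilde\eta_0x+(1-\mathbf u)\tilde\eta_1y+(1-\mathbf w)\tilde\eta_2z\big).$$ Let $\langle\,,\,\rangle$ be the symmetric bilinear form on $V$ for which the monomials $x^ry^sz^t$ ($r,s,t\ge0$, $r+s+t=N$) are mutually orthogonal and $$\langle x^ry^sz^t,x^ry^sz^t\rangle=\frac{r!\,s!\,t!}{\tilde\eta_0^r\tilde\eta_1^s\tilde\eta_2^t}\,\vartheta^N .$$ *)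

theory Defs
  imports Complex_Main "HOL-Library.Poly_Mapping" "HOL-Library.Product_Plus"
begin

section \<open>The parameters\<close>

definition psum :: "complex \<Rightarrow> complex \<Rightarrow> complex \<Rightarrow> complex \<Rightarrow> complex" where
  "psum p1 p2 p3 p4 = p1 + p2 + p3 + p4"

definition bold_t :: "complex \<Rightarrow> complex \<Rightarrow> complex \<Rightarrow> complex \<Rightarrow> complex" where
  "bold_t p1 p2 p3 p4 = (p1 + p2) * (p1 + p3) / (p1 * psum p1 p2 p3 p4)"

definition bold_u :: "complex \<Rightarrow> complex \<Rightarrow> complex \<Rightarrow> complex \<Rightarrow> complex" where
  "bold_u p1 p2 p3 p4 = (p1 + p3) * (p3 + p4) / (p3 * psum p1 p2 p3 p4)"

definition bold_v :: "complex \<Rightarrow> complex \<Rightarrow> complex \<Rightarrow> complex \<Rightarrow> complex" where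
  "bold_v p1 p2 p3 p4 = (p1 + p2) * (p2 + p4) / (p2 * psum p1 p2 p3 p4)"

definition bold_w :: "complex \<Rightarrow> complex \<Rightarrow> complex \<Rightarrow> complex \<Rightarrow> complex" where
  "bold_w p1 p2 p3 p4 = (p2 + p4) * (p3 + p4) / (p4 * psum p1 p2 p3 p4)"

definition nu :: "complex \<Rightarrow> complex \<Rightarrow> complex \<Rightarrow> complex \<Rightarrow> complex" where
  "nu p1 p2 p3 p4 =
     (p1 + p2) * (p1 + p3) * (p2 + p4) * (p3 + p4) / (p1 * p4 - p2 * p3)\<^sup>2"

definition eta0' :: "complex \<Rightarrow> complex \<Rightarrow> complex \<Rightarrow> complex \<Rightarrow> complex" where
  "eta0' p1 p2 p3 p4 = inverse (nu p1 p2 p3 p4)"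

definition eta1' :: "complex \<Rightarrow> complex \<Rightarrow> complex \<Rightarrow> complex \<Rightarrow> complex" where
  "eta1' p1 p2 p3 p4 = p1 * p3 * psum p1 p2 p3 p4 / ((p1 + p2) * (p1 + p3) * (p3 + p4))"

definition eta2' :: "complex \<Rightarrow> complex \<Rightarrow> complex \<Rightarrow> complex \<Rightarrow> complex" where
  "eta2' p1 p2 p3 p4 = p2 * p4 * psum p1 p2 p3 p4 / ((p1 + p2) * (p2 + p4) * (p3 + p4))"

definition vtheta :: "complex \<Rightarrow> complex \<Rightarrow> complex \<Rightarrow> complex \<Rightarrow> complex" where
  "vtheta p1 p2 p3 p4 = (p1 + p3) * (p2 + p4) / (p2 * p3 - p1 * p4)"

definition vtheta' :: "complex \<Rightarrow> complex \<Rightarrow> complex \<Rightarrow> complex \<Rightarrow> complex" where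
  "vtheta' p1 p2 p3 p4 = (p1 + p2) * (p3 + p4) / (p2 * p3 - p1 * p4)"

text \<open>
  The denominator \<open>(-N)\<^sub>n\<close> does not vanish for \<open>n \<le> N\<close>, so every summand is a genuine quotient.
\<close>

definition P ::
  "complex \<Rightarrow> complex \<Rightarrow> complex \<Rightarrow> complex \<Rightarrow> nat \<Rightarrow>
   complex \<Rightarrow> complex \<Rightarrow> complex \<Rightarrow> complex \<Rightarrow> complex" where
  "P p1 p2 p3 p4 N a b c d =
     (\<Sum>(i, j, k, l) \<in> {(i, j, k, l). i + j + k + l \<le> N}.
        pochhammer (- a) (i + j) * pochhammer (- b) (k + l) *
        pochhammer (- c) (i + k) * pochhammer (- d) (j + l) /
        (fact i * fact j * fact k * fact l * pochhammer (- of_nat N) (i + j + k + l)) *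
        bold_t p1 p2 p3 p4 ^ i * bold_u p1 p2 p3 p4 ^ j *
        bold_v p1 p2 p3 p4 ^ k * bold_w p1 p2 p3 p4 ^ l)"

lemma finite_P_indices: "finite {(i, j, k, l). i + j + k + l \<le> (N :: nat)}"
  by (rule finite_subset[of _ "{..N} \<times> {..N} \<times> {..N} \<times> {..N}"]) auto

section \<open>Polynomials in three variables\<close>

text \<open>
  The polynomial ring in \<open>x, y, z\<close> is the monoid algebra over the exponent triples:
  \<^term>\<open>Poly_Mapping.lookup f (r, s, t)\<close> is the coefficient of \<open>x\<^sup>r y\<^sup>s z\<^sup>t\<close> in \<open>f\<close>.
\<close>

type_synonym poly3 = "(nat \<times> nat \<times> nat) \<Rightarrow>\<^sub>0 complex"

definition scl :: "complex \<Rightarrow> poly3 \<Rightarrow> poly3" where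
  "scl c f = Poly_Mapping.single 0 c * f"

definition X :: poly3 where "X = Poly_Mapping.single (1, 0, 0) 1"
definition Y :: poly3 where "Y = Poly_Mapping.single (0, 1, 0) 1"
definition Z :: poly3 where "Z = Poly_Mapping.single (0, 0, 1) 1"

definition V :: "nat \<Rightarrow> poly3 set" where
  "V N = {f. \<forall>(r, s, t) \<in> Poly_Mapping.keys f. r + s + t = N}"

definition X' :: "complex \<Rightarrow> complex \<Rightarrow> complex \<Rightarrow> complex \<Rightarrow> poly3" where
  "X' p1 p2 p3 p4 =
     scl (vtheta' p1 p2 p3 p4)
       (scl (eta0' p1 p2 p3 p4) X + scl (eta1' p1 p2 p3 p4) Y + scl (eta2' p1 p2 p3 p4) Z)"

definition Y' :: "complex \<Rightarrow> complex \<Rightarrow> complex \<Rightarrow> complex \<Rightarrow> poly3" where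
  "Y' p1 p2 p3 p4 =
     scl (vtheta' p1 p2 p3 p4)
       (scl (eta0' p1 p2 p3 p4) X
        + scl ((1 - bold_t p1 p2 p3 p4) * eta1' p1 p2 p3 p4) Y
        + scl ((1 - bold_v p1 p2 p3 p4) * eta2' p1 p2 p3 p4) Z)"

definition Z' :: "complex \<Rightarrow> complex \<Rightarrow> complex \<Rightarrow> complex \<Rightarrow> poly3" where
  "Z' p1 p2 p3 p4 =
     scl (vtheta' p1 p2 p3 p4)
       (scl (eta0' p1 p2 p3 p4) X
        + scl ((1 - bold_u p1 p2 p3 p4) * eta1' p1 p2 p3 p4) Y
        + scl ((1 - bold_w p1 p2 p3 p4) * eta2' p1 p2 p3 p4) Z)"

section \<open>The bilinear form\<close>

definition symmetric_bilinear_on :: "poly3 set \<Rightarrow> (poly3 \<Rightarrow> poly3 \<Rightarrow> complex) \<Rightarrow> bool" where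
  "symmetric_bilinear_on W B \<longleftrightarrow>
     (\<forall>f\<in>W. \<forall>g\<in>W. B f g = B g f) \<and>
     (\<forall>f\<in>W. \<forall>g\<in>W. \<forall>h\<in>W. B (f + g) h = B f h + B g h) \<and>
     (\<forall>c. \<forall>f\<in>W. \<forall>h\<in>W. B (scl c f) h = c * B f h)"

definition mono_norm ::
  "complex \<Rightarrow> complex \<Rightarrow> complex \<Rightarrow> complex \<Rightarrow> nat \<Rightarrow> nat \<Rightarrow> nat \<Rightarrow> nat \<Rightarrow> complex" where
  "mono_norm p1 p2 p3 p4 N r s t =
     fact r * fact s * fact t
       / (eta0' p1 p2 p3 p4 ^ r * eta1' p1 p2 p3 p4 ^ s * eta2' p1 p2 p3 p4 ^ t)
       * vtheta p1 p2 p3 p4 ^ N"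

text \<open>
  The values of \<open>B\<close> outside \<^term>\<open>V N\<close> are irrelevant.  The lemmas below show that such a \<open>B\<close>
  exists and that its restriction to \<^term>\<open>V N\<close> is unique.
\<close>

definition is_the_form ::
  "complex \<Rightarrow> complex \<Rightarrow> complex \<Rightarrow> complex \<Rightarrow> nat \<Rightarrow> (poly3 \<Rightarrow> poly3 \<Rightarrow> complex) \<Rightarrow> bool" where
  "is_the_form p1 p2 p3 p4 N B \<longleftrightarrow>
     symmetric_bilinear_on (V N) B \<and>
     (\<forall>r s t r' s' t'. r + s + t = N \<longrightarrow> r' + s' + t' = N \<longrightarrow> (r, s, t) \<noteq> (r', s', t') \<longrightarrow>
        B (X ^ r * Y ^ s * Z ^ t) (X ^ r' * Y ^ s' * Z ^ t') = 0) \<and>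
     (\<forall>r s t. r + s + t = N \<longrightarrow>
        B (X ^ r * Y ^ s * Z ^ t) (X ^ r * Y ^ s * Z ^ t) = mono_norm p1 p2 p3 p4 N r s t)"

lemma X_power: "X ^ r = Poly_Mapping.single (r, 0, 0) 1"
  by (induction r) (simp_all add: X_def mult_single zero_prod_def[symmetric])

lemma Y_power: "Y ^ r = Poly_Mapping.single (0, r, 0) 1"
  by (induction r) (simp_all add: Y_def mult_single zero_prod_def[symmetric])

lemma Z_power: "Z ^ r = Poly_Mapping.single (0, 0, r) 1"
  by (induction r) (simp_all add: Z_def mult_single zero_prod_def[symmetric])

lemma monomial: "X ^ r * Y ^ s * Z ^ t = Poly_Mapping.single (r, s, t) 1"
  by (simp add: X_power Y_power Z_power mult_single)

lemma lookup_scl: "Poly_Mapping.lookup (scl c f) m = c * Poly_Mapping.lookup f m"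
  by (simp add: scl_def mult_map_scale_conv_mult[symmetric] Poly_Mapping.map.rep_eq when_def)

lemma scl_single: "scl c (Poly_Mapping.single m d) = Poly_Mapping.single m (c * d)"
  by (simp add: scl_def mult_single)

lemma finite_degree: "finite {(r, s, t). r + s + t = (N :: nat)}"
  by (rule finite_subset[of _ "{..N} \<times> {..N} \<times> {..N}"]) auto

lemma single_in_V: "r + s + t = N \<Longrightarrow> Poly_Mapping.single (r, s, t) c \<in> V N"
  by (simp add: V_def)

lemma zero_in_V: "0 \<in> V N"
  by (simp add: V_def)

lemma add_in_V: "f \<in> V N \<Longrightarrow> g \<in> V N \<Longrightarrow> f + g \<in> V N"
  using keys_add[of f g] by (fastforce simp: V_def)

lemma scl_in_V: "f \<in> V N \<Longrightarrow> scl c f \<in> V N"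
  by (auto simp: V_def in_keys_iff lookup_scl)

lemma is_the_form_exists: "\<exists>B. is_the_form p1 p2 p3 p4 N B"
proof
  let ?D = "{(r, s, t). r + s + t = N}"
  let ?n = "\<lambda>(r, s, t). mono_norm p1 p2 p3 p4 N r s t"
  let ?B = "\<lambda>(f :: poly3) (g :: poly3). \<Sum>m\<in>?D. Poly_Mapping.lookup f m * Poly_Mapping.lookup g m * ?n m"
  have val: "?B (Poly_Mapping.single m 1) (Poly_Mapping.single m' 1) = (if m = m' then ?n m else 0)"
    if "m \<in> ?D" for m m'
  proof -
    have "?B (Poly_Mapping.single m 1) (Poly_Mapping.single m' 1) =
        (\<Sum>k\<in>?D. if k = m then (if m = m' then ?n m else 0) else 0)"
      by (rule sum.cong) (auto simp: lookup_single when_def)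
    then show ?thesis
      using that finite_degree[of N] by (simp add: sum.delta)
  qed
  have "symmetric_bilinear_on (V N) ?B"
    unfolding symmetric_bilinear_on_def
    by (auto simp: lookup_add lookup_scl algebra_simps sum.distrib sum_distrib_left
          case_prod_unfold)
  then show "is_the_form p1 p2 p3 p4 N ?B"
    unfolding is_the_form_def monomial using val by auto
qed

lemma V_induct [consumes 1, case_names zero add]:
  assumes "f \<in> V N"
    and "Q 0"
    and "\<And>r s t c g. r + s + t = N \<Longrightarrow> g \<in> V N \<Longrightarrow> Q g \<Longrightarrow>
           Q (scl c (X ^ r * Y ^ s * Z ^ t) + g)"
  shows "Q f"
proof -
  have expand: "f = (\<Sum>m\<in>Poly_Mapping.keys f. Poly_Mapping.single m (Poly_Mapping.lookup f m))"
    by (rule poly_mapping_eqI) (simp add: lookup_sum lookup_single when_def in_keys_iff)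
  have "A \<subseteq> Poly_Mapping.keys f \<Longrightarrow>
      (\<Sum>m\<in>A. Poly_Mapping.single m (Poly_Mapping.lookup f m)) \<in> V N \<and>
      Q (\<Sum>m\<in>A. Poly_Mapping.single m (Poly_Mapping.lookup f m))" if "finite A" for A
    using that
  proof (induction A)
    case empty
    then show ?case using assms(2) by (simp add: zero_in_V)
  next
    case (insert m A)
    obtain r s t where m: "m = (r, s, t)" by (cases m)
    have "r + s + t = N" using insert.prems assms(1) by (auto simp: V_def m)
    then show ?case
      using insert assms(3)[of r s t "\<Sum>m\<in>A. Poly_Mapping.single m (Poly_Mapping.lookup f m)" "Poly_Mapping.lookup f m"]
      by (auto simp: m monomial scl_single intro: add_in_V single_in_V)
  qed
  from this[of "Poly_Mapping.keys f"] show ?thesis using expand by simp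
qed

lemma is_the_form_unique:
  assumes B: "is_the_form p1 p2 p3 p4 N B" and C: "is_the_form p1 p2 p3 p4 N C"
    and f: "f \<in> V N" and g: "g \<in> V N"
  shows "B f g = C f g"
proof -
  have sym: "F a b = F b a"
    and add: "F (a + a') b = F a b + F a' b"
    and scl: "F (scl c a) b = c * F a b"
    if "is_the_form p1 p2 p3 p4 N F" "a \<in> V N" "a' \<in> V N" "b \<in> V N" for F a a' b c
    using that unfolding is_the_form_def symmetric_bilinear_on_def by blast+
  have F0: "F 0 b = 0" if "is_the_form p1 p2 p3 p4 N F" "b \<in> V N" for F b
    using scl[OF that(1) zero_in_V zero_in_V that(2), of 0] by (simp add: scl_def)
  have mV: "X ^ r * Y ^ s * Z ^ t \<in> V N" if "r + s + t = N" for r s t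
    using that by (simp add: monomial single_in_V)
  have mono: "B (X ^ r * Y ^ s * Z ^ t) (X ^ r' * Y ^ s' * Z ^ t') =
      C (X ^ r * Y ^ s * Z ^ t) (X ^ r' * Y ^ s' * Z ^ t')"
    if "r + s + t = N" "r' + s' + t' = N" for r s t r' s' t'
    using B C that unfolding is_the_form_def
    by (cases "(r, s, t) = (r', s', t')") simp_all
  have comb: "F (scl c a + a') b = c * F a b + F a' b"
    if "is_the_form p1 p2 p3 p4 N F" "a \<in> V N" "a' \<in> V N" "b \<in> V N" for F a a' b c
    using that add[of F "scl c a" a' b] scl[of F a a' b c] by (simp add: scl_in_V)
  have half: "B h (X ^ r * Y ^ s * Z ^ t) = C h (X ^ r * Y ^ s * Z ^ t)"
    if "h \<in> V N" "r + s + t = N" for h r s t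
    using that(1)
  proof (induction rule: V_induct)
    case zero
    then show ?case using F0[OF B] F0[OF C] mV[OF that(2)] by simp
  next
    case (add r' s' t' c h)
    then show ?case
      using that(2) by (simp add: comb[OF B] comb[OF C] mV mono)
  qed
  from f show ?thesis
  proof (induction rule: V_induct)
    case zero
    then show ?case using F0[OF B] F0[OF C] g by simp
  next
    case (add r s t c h)
    have "B (X ^ r * Y ^ s * Z ^ t) g = C (X ^ r * Y ^ s * Z ^ t) g"
      using sym[OF B mV mV g] sym[OF C mV mV g] half[OF g] add.hyps by metis
    then show ?case
      using add g by (simp add: comb[OF B] comb[OF C] mV)
  qed
qed

end

theory Submission
  imports Defs
begin

text \<open>
  Put \<open>L = \<eta>\<^sub>0 x + \<eta>\<^sub>1 y + \<eta>\<^sub>2 z\<close> (with tildes dropped). Up to the factor \<open>\<vartheta>\<close>, the three linear forms are \<open>L\<close>,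
  \<open>L - \<t> \<eta>\<^sub>1 y - \<v> \<eta>\<^sub>2 z\<close> and \<open>L - \<u> \<eta>\<^sub>1 y - \<w> \<eta>\<^sub>2 z\<close>. Pairing with a monomial extracts a
  coefficient, and the weights of the form cancel the \<open>\<eta>\<close>'s in it. Expanding the powers of the last
  two forms by the trinomial theorem gives a sum over \<open>i, j, k, l\<close> of coefficients of
  \<open>y\<^bsup>i+j\<^esup> z\<^bsup>k+l\<^esup> L\<^bsup>N-i-j-k-l\<^esup>\<close>, which matches the series \<^const>\<open>P\<close> term by term.
  Apart from making the \<open>\<eta>\<close>'s nonzero, the special shape of the parameters enters only through the
  product of the two \<open>\<vartheta>\<close>'s being \<open>\<nu>\<close>.
\<close>

section \<open>Trinomial expansion and Pochhammer symbols at negative integers\<close>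

lemma finite_add_le: "finite {(i, k). i + k \<le> (n :: nat)}"
  by (rule finite_subset[of _ "{..n} \<times> {..n}"]) auto

text \<open>The binomial theorem applied twice. The exponent of \<open>c\<close> is the remainder
  and not an index, so that later only the exponents of \<open>y\<close> and \<open>z\<close> are
  summed over.\<close>

lemma trinomial:
  fixes a b c :: "'a :: comm_semiring_1"
  shows "(a + b + c) ^ n =
    (\<Sum>(i, k)\<in>{(i, k). i + k \<le> n}.
       of_nat ((n choose i) * ((n - i) choose k)) * (a ^ i * b ^ k * c ^ (n - (i + k))))"
proof -
  have "(a + b + c) ^ n = (\<Sum>i\<le>n. of_nat (n choose i) * a ^ i * (b + c) ^ (n - i))"
    unfolding add.assoc by (rule binomial_ring)
  also have "\<dots> = (\<Sum>i\<le>n. \<Sum>k\<le>n - i.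
      of_nat ((n choose i) * ((n - i) choose k)) * (a ^ i * b ^ k * c ^ (n - (i + k))))"
    by (simp add: binomial_ring sum_distrib_left mult_ac)
  also have "\<dots> = (\<Sum>(i, k)\<in>(SIGMA i:{..n}. {..n - i}).
      of_nat ((n choose i) * ((n - i) choose k)) * (a ^ i * b ^ k * c ^ (n - (i + k))))"
    by (rule sum.Sigma) auto
  also have "(SIGMA i:{..n}. {..n - i}) = {(i, k). i + k \<le> n}"
    by auto
  finally show ?thesis .
qed

text \<open>Up to sign the symbol is \<open>fact k\<close> times a binomial coefficient. For
  \<open>k > n\<close> it vanishes, and that case is treated separately below.\<close>

lemma pochhammer_minus_of_nat:
  assumes "k \<le> n"
  shows "pochhammer (- of_nat n) k = ((- 1) ^ k * (fact n / fact (n - k)) :: 'a :: field_char_0)"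
proof -
  have "pochhammer (- of_nat n) k = (- 1) ^ k * (fact k * of_nat (n choose k) :: 'a)"
    by (simp add: binomial_gbinomial gbinomial_pochhammer)
  then show ?thesis
    using assms by (simp add: binomial_fact)
qed

lemma trinomial_coeff_fact:
  assumes "i + k \<le> n"
  shows "of_nat ((n choose i) * ((n - i) choose k)) =
    (fact n / (fact i * fact k * fact (n - (i + k))) :: 'a :: field_char_0)"
  using assms by (simp add: binomial_fact)

section \<open>Coefficients of powers of linear forms\<close>

lemma single_power:
  "Poly_Mapping.single (a, b, c) e ^ n =
    (Poly_Mapping.single (n * a, n * b, n * c) (e ^ n) :: poly3)"
  by (induction n) (simp_all add: mult_single zero_prod_def[symmetric])

text \<open>Scalars as constant polynomials: \<open>scl c f\<close> unfolds to
  \<open>cst c * f\<close>, so scalars can be moved by ring rewriting alone.\<close>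

abbreviation cst :: "complex \<Rightarrow> poly3" where
  "cst \<equiv> Poly_Mapping.single 0"

lemma cst_mult: "cst (c * d) = cst c * cst d"
  by (simp add: mult_single)

lemma cst_power: "cst (c ^ n) = cst c ^ n"
  by (induction n) (simp_all add: cst_mult)

lemma cst_of_nat: "cst (of_nat n) = of_nat n"
  by simp

abbreviation linear_form :: "complex \<Rightarrow> complex \<Rightarrow> complex \<Rightarrow> poly3" where
  "linear_form e0 e1 e2 \<equiv> scl e0 X + scl e1 Y + scl e2 Z"

lemma linear_form_power:
  "linear_form e0 e1 e2 ^ n =
    (\<Sum>(i, k)\<in>{(i, k). i + k \<le> n}.
       Poly_Mapping.single (n - (i + k), i, k)
         (of_nat ((n choose i) * ((n - i) choose k)) * (e0 ^ (n - (i + k)) * e1 ^ i * e2 ^ k)))"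
proof -
  have "linear_form e0 e1 e2 ^ n = (scl e1 Y + scl e2 Z + scl e0 X) ^ n"
    by (simp add: add_ac)
  also have "\<dots> = (\<Sum>(i, k)\<in>{(i, k). i + k \<le> n}.
       Poly_Mapping.single (n - (i + k), i, k)
         (of_nat ((n choose i) * ((n - i) choose k)) * (e0 ^ (n - (i + k)) * e1 ^ i * e2 ^ k)))"
    unfolding trinomial
    by (rule sum.cong) (auto simp: X_def Y_def Z_def scl_single single_power mult_single
        single_of_nat[symmetric] mult_ac simp del: single_of_nat of_nat_mult)
  finally show ?thesis .
qed

text \<open>One term of the trinomial expansion hits the given exponent. The weights
  \<open>e1 ^ a * e2 ^ b\<close> on the monomial make the power product in the result independent of
  \<open>a\<close> and \<open>b\<close>, so it can later leave the sum.\<close>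

lemma lookup_monomial_times_linear_form_power:
  assumes deg: "r + s + t = a + b + n"
  shows "Poly_Mapping.lookup
      (Poly_Mapping.single (0, a, b) (e1 ^ a * e2 ^ b) * linear_form e0 e1 e2 ^ n) (r, s, t) =
    (if a \<le> s \<and> b \<le> t
     then fact n / (fact r * fact (s - a) * fact (t - b)) * (e0 ^ r * e1 ^ s * e2 ^ t) else 0)"
    (is "?L = ?R")
proof -
  let ?S = "{(i, k). i + k \<le> n}"
  let ?f = "\<lambda>i k. of_nat ((n choose i) * ((n - i) choose k)) *
              (e0 ^ (n - (i + k)) * e1 ^ (a + i) * e2 ^ (b + k))"
  have "?L = (\<Sum>(i, k)\<in>?S. Poly_Mapping.lookup
      (Poly_Mapping.single (n - (i + k), a + i, b + k) (?f i k)) (r, s, t))"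
    unfolding linear_form_power sum_distrib_left lookup_sum
    by (rule sum.cong) (auto simp: mult_single power_add mult_ac)
  \<comment> \<open>The inner conditional guards against truncated subtraction: for
    \<open>a > s\<close> the value \<open>s - a\<close> is 0, which would select a wrong
    index.\<close>
  also have "\<dots> = (\<Sum>q\<in>?S. if q = (s - a, t - b) then
      (if a \<le> s \<and> b \<le> t then ?f (s - a) (t - b) else 0) else 0)"
  proof (rule sum.cong)
    fix q assume "q \<in> ?S"
    then obtain i k where q: "q = (i, k)" "i + k \<le> n"
      by auto
    show "(case q of (i, k) \<Rightarrow> Poly_Mapping.lookup
        (Poly_Mapping.single (n - (i + k), a + i, b + k) (?f i k)) (r, s, t)) =
      (if q = (s - a, t - b) then
        (if a \<le> s \<and> b \<le> t then ?f (s - a) (t - b) else 0) else 0)"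
    proof (cases "a + i = s \<and> b + k = t")
      case True
      then have "s = a + i" "t = b + k" "n - (i + k) = r"
        using deg q(2) by auto
      then show ?thesis
        by (simp add: q(1) lookup_single)
    next
      case False
      then have "\<not> (q = (s - a, t - b) \<and> a \<le> s \<and> b \<le> t)"
        by (auto simp: q(1))
      with False show ?thesis
        by (auto simp: q(1) lookup_single when_def)
    qed
  qed simp
  also have "\<dots> = (if (s - a, t - b) \<in> ?S then
      (if a \<le> s \<and> b \<le> t then ?f (s - a) (t - b) else 0) else 0)"
    by (rule sum.delta) (rule finite_add_le)
  also have "\<dots> = ?R"
  proof (cases "a \<le> s \<and> b \<le> t")
    case True
    then have le: "s - a + (t - b) \<le> n"
      and eqs: "n - (s - a + (t - b)) = r" "a + (s - a) = s" "b + (t - b) = t"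
      using deg by auto
    from le have mem: "(s - a, t - b) \<in> ?S"
      by simp
    show ?thesis
      unfolding if_P[OF True] if_P[OF mem] trinomial_coeff_fact[OF le] eqs
      by (simp only: mult_ac)
  qed auto
  finally show ?thesis .
qed

section \<open>From the coefficient to the hypergeometric sum\<close>

text \<open>
  Here \<open>t, u, v, w\<close> are free; the sum is the one defining \<^const>\<open>P\<close>.
\<close>
lemma lookup_product_of_powers:
  fixes e0 e1 e2 t u v w :: complex
  assumes rab: "r + a + b = N" and qcd: "q + c + d = N"
  shows "fact r * fact a * fact b * Poly_Mapping.lookup
      (linear_form e0 e1 e2 ^ q * linear_form e0 ((1 - t) * e1) ((1 - v) * e2) ^ c *
       linear_form e0 ((1 - u) * e1) ((1 - w) * e2) ^ d) (r, a, b) =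
    e0 ^ r * e1 ^ a * e2 ^ b * fact N *
    (\<Sum>(i, j, k, l) \<in> {(i, j, k, l). i + j + k + l \<le> N}.
        pochhammer (- of_nat a) (i + j) * pochhammer (- of_nat b) (k + l) *
        pochhammer (- of_nat c) (i + k) * pochhammer (- of_nat d) (j + l) /
        (fact i * fact j * fact k * fact l * pochhammer (- of_nat N) (i + j + k + l)) *
        t ^ i * u ^ j * v ^ k * w ^ l)"
proof -
  let ?L = "linear_form e0 e1 e2"
  let ?y = "scl e1 Y" and ?z = "scl e2 Z"
  let ?m = "\<lambda>n i k. of_nat ((n choose i) * ((n - i) choose k)) :: complex"
  let ?T = "\<lambda>n. {(i, k). i + k \<le> (n :: nat)}"
  let ?I = "{(i, j, k, l). i + k \<le> c \<and> j + l \<le> d}"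
  let ?g = "\<lambda>i j k l. ?m c i k * ?m d j l * ((- t) ^ i * (- u) ^ j * (- v) ^ k * (- w) ^ l)"
  have pow: "linear_form e0 ((1 - f) * e1) ((1 - g) * e2) ^ n =
      (\<Sum>(i, k)\<in>?T n. cst (?m n i k * ((- f) ^ i * (- g) ^ k)) *
        (?y ^ i * ?z ^ k * ?L ^ (n - (i + k))))" for f g n
  proof -
    have "linear_form e0 ((1 - f) * e1) ((1 - g) * e2) = cst (- f) * ?y + cst (- g) * ?z + ?L"
      by (rule poly_mapping_eqI)
        (simp only: lookup_add lookup_scl scl_def[symmetric], simp add: algebra_simps)
    then show ?thesis
      by (simp only: trinomial cst_mult cst_power cst_of_nat power_mult_distrib mult_ac)
  qed
  have yz: "?y ^ i * ?z ^ k = Poly_Mapping.single (0, i, k) (e1 ^ i * e2 ^ k)" for i k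
    by (simp add: Y_def Z_def scl_single single_power mult_single)
  have "?L ^ q * linear_form e0 ((1 - t) * e1) ((1 - v) * e2) ^ c *
       linear_form e0 ((1 - u) * e1) ((1 - w) * e2) ^ d =
     (\<Sum>(i, k)\<in>?T c. \<Sum>(j, l)\<in>?T d. scl (?g i j k l)
        (?y ^ (i + j) * ?z ^ (k + l) * ?L ^ (N - (i + j + k + l))))"
  proof -
    have "?L ^ q * (cst (?m c i k * ((- t) ^ i * (- v) ^ k)) * (?y ^ i * ?z ^ k * ?L ^ (c - (i + k)))) *
        (cst (?m d j l * ((- u) ^ j * (- w) ^ l)) * (?y ^ j * ?z ^ l * ?L ^ (d - (j + l)))) =
      scl (?g i j k l) (?y ^ (i + j) * ?z ^ (k + l) * ?L ^ (N - (i + j + k + l)))"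
      if "i + k \<le> c" "j + l \<le> d" for i j k l
    proof -
      \<comment> \<open>The powers of \<open>?L\<close> left over from the three factors combine
        into one, since \<open>q + c + d = N\<close>.\<close>
      have "N - (i + j + k + l) = q + (c - (i + k)) + (d - (j + l))"
        using that qcd by auto
      moreover have "cst (?g i j k l) =
          cst (?m c i k * ((- t) ^ i * (- v) ^ k)) * cst (?m d j l * ((- u) ^ j * (- w) ^ l))"
        by (simp add: mult_single mult_ac)
      ultimately show ?thesis
        by (simp add: scl_def power_add mult_ac del: of_nat_mult)
    qed
    then show ?thesis
      unfolding pow sum_distrib_left sum_distrib_right case_prod_unfold
      by (subst sum.swap) (auto intro!: sum.cong)
  qed
  also have "\<dots> = (\<Sum>(i, j, k, l)\<in>?I. scl (?g i j k l)
        (?y ^ (i + j) * ?z ^ (k + l) * ?L ^ (N - (i + j + k + l))))"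
    unfolding case_prod_unfold sum.cartesian_product
    by (rule sum.reindex_bij_witness[of _ "\<lambda>(i, j, k, l). ((i, k), (j, l))"
          "\<lambda>((i, k), (j, l)). (i, j, k, l)"]) auto
  finally have expand: "?L ^ q * linear_form e0 ((1 - t) * e1) ((1 - v) * e2) ^ c *
       linear_form e0 ((1 - u) * e1) ((1 - w) * e2) ^ d = \<dots>" .
  have term_eq: "fact r * fact a * fact b * Poly_Mapping.lookup (scl (?g i j k l)
        (?y ^ (i + j) * ?z ^ (k + l) * ?L ^ (N - (i + j + k + l)))) (r, a, b) =
      e0 ^ r * e1 ^ a * e2 ^ b * fact N *
      (pochhammer (- of_nat a) (i + j) * pochhammer (- of_nat b) (k + l) *
        pochhammer (- of_nat c) (i + k) * pochhammer (- of_nat d) (j + l) /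
        (fact i * fact j * fact k * fact l * pochhammer (- of_nat N) (i + j + k + l)) *
        t ^ i * u ^ j * v ^ k * w ^ l)"
    if c: "i + k \<le> c" and d: "j + l \<le> d" for i j k l
  \<comment> \<open>If this fails, both sides vanish: the monomial does not divide the target
    monomial, and one of the first two Pochhammer symbols is 0.\<close>
  proof (cases "i + j \<le> a \<and> k + l \<le> b")
    case True
    define n where "n = i + j + k + l"
    have n: "n \<le> N" "r + a + b = (i + j) + (k + l) + (N - n)"
      using c d qcd rab by (auto simp: n_def)
    have fact_nonzero: "fact m \<noteq> (0 :: complex)" for m
      by simp
    \<comment> \<open>\<open>S\<close> arises on the left from the negated arguments and on the
      right in the denominator, from the symbol of \<open>- of_nat N\<close>; being its own inverse,
      it matches.\<close>
    define S :: complex where "S = (- 1) ^ n"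
    have inverse_S: "inverse S = S"
      by (cases "even n") (simp_all add: S_def)
    \<comment> \<open>Each index occurs in exactly two of the exponents.\<close>
    have "(- 1) ^ (i + j) * (- 1) ^ (k + l) * (- 1) ^ (i + k) * (- 1) ^ (j + l) = (1 :: complex)"
      unfolding power_add[symmetric] by (rule neg_one_even_power) presburger
    then have signs_cancel: "(- 1) ^ (i + j) * A * ((- 1) ^ (k + l) * B) * ((- 1) ^ (i + k) * C) *
        ((- 1) ^ (j + l) * D) = A * B * C * D" for A B C D :: complex
      by (simp add: mult_ac power_add)
    have poch: "pochhammer (- of_nat a) (i + j) * pochhammer (- of_nat b) (k + l) *
        pochhammer (- of_nat c) (i + k) * pochhammer (- of_nat d) (j + l) =
        (fact a / fact (a - (i + j)) * (fact b / fact (b - (k + l))) *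
        (fact c / fact (c - (i + k))) * (fact d / fact (d - (j + l))) :: complex)"
      unfolding pochhammer_minus_of_nat[OF c] pochhammer_minus_of_nat[OF d]
        pochhammer_minus_of_nat[OF conjunct1[OF True]] pochhammer_minus_of_nat[OF conjunct2[OF True]]
      by (rule signs_cancel)
    have args: "(- t) ^ i * (- u) ^ j * (- v) ^ k * (- w) ^ l = S * (t ^ i * u ^ j * v ^ k * w ^ l)"
      unfolding power_minus[of t] power_minus[of u] power_minus[of v] power_minus[of w]
        S_def n_def power_add
      by (simp only: mult_ac)
    \<comment> \<open>The factorials become opaque variables. Only \<open>R\<close> (for
      \<open>fact r\<close>) and \<open>F\<close> (for \<open>fact N\<close>) truly cancel; the rest
      is rearrangement of products and inverses.\<close>
    have cancel: "R * A * B' * (C / (I * K * C') * (D / (J * L * D')) * (S * T) *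
          (M / (R * A' * B'') * E)) =
        E * F * (A / A' * (B' / B'') * (C / C') * (D / D') / (I * J * K * L * (S * (F / M))) * T)"
      (is "?lhs = ?rhs")
      if "R \<noteq> 0" "F \<noteq> 0"
      for R A B' C I K C' D J L D' T M A' B'' E F :: complex
    proof -
      let ?X = "S * T * E * M * (A / A' * (B' / B'') * (C / C') * (D / D') / (I * J * K * L))"
      have "?lhs = R / R * ?X"
        by (simp only: divide_inverse inverse_mult_distrib mult_ac)
      also have "\<dots> = F / F * ?X"
        using that by simp
      also have "\<dots> = ?rhs"
        by (simp only: divide_inverse inverse_mult_distrib inverse_inverse_eq inverse_S mult_ac)
      finally show ?thesis .
    qed
    show ?thesis
      unfolding lookup_scl yz n_def[symmetric] lookup_monomial_times_linear_form_power[OF n(2)]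
        trinomial_coeff_fact[OF c] trinomial_coeff_fact[OF d] pochhammer_minus_of_nat[OF n(1)]
        S_def[symmetric] poch args if_P[OF True]
        cancel[OF fact_nonzero[of r] fact_nonzero[of N]]
      by (simp only: mult_ac)
  next
    case False
    have n: "r + a + b = (i + j) + (k + l) + (N - (i + j + k + l))"
      using c d qcd rab by auto
    have "pochhammer (- of_nat a) (i + j) * pochhammer (- of_nat b) (k + l) = (0 :: complex)"
      using False by (metis linorder_not_le mult_eq_0_iff pochhammer_of_nat_eq_0_lemma)
    then show ?thesis
      unfolding lookup_scl yz lookup_monomial_times_linear_form_power[OF n] if_not_P[OF False]
      by (simp only: mult_zero_left mult_zero_right div_0)
  qed
  have "fact r * fact a * fact b * Poly_Mapping.lookup
      (?L ^ q * linear_form e0 ((1 - t) * e1) ((1 - v) * e2) ^ c *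
       linear_form e0 ((1 - u) * e1) ((1 - w) * e2) ^ d) (r, a, b) =
    e0 ^ r * e1 ^ a * e2 ^ b * fact N *
    (\<Sum>(i, j, k, l) \<in> ?I.
        pochhammer (- of_nat a) (i + j) * pochhammer (- of_nat b) (k + l) *
        pochhammer (- of_nat c) (i + k) * pochhammer (- of_nat d) (j + l) /
        (fact i * fact j * fact k * fact l * pochhammer (- of_nat N) (i + j + k + l)) *
        t ^ i * u ^ j * v ^ k * w ^ l)"
    unfolding expand lookup_sum sum_distrib_left
    by (rule sum.cong) (auto simp only: mem_Collect_eq case_prod_conv term_eq)
  also have "(\<Sum>(i, j, k, l) \<in> ?I.
        pochhammer (- of_nat a) (i + j) * pochhammer (- of_nat b) (k + l) *
        pochhammer (- of_nat c) (i + k) * pochhammer (- of_nat d) (j + l) /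
        (fact i * fact j * fact k * fact l * pochhammer (- of_nat N) (i + j + k + l)) *
        t ^ i * u ^ j * v ^ k * w ^ l) =
    (\<Sum>(i, j, k, l) \<in> {(i, j, k, l). i + j + k + l \<le> N}.
        pochhammer (- of_nat a) (i + j) * pochhammer (- of_nat b) (k + l) *
        pochhammer (- of_nat c) (i + k) * pochhammer (- of_nat d) (j + l) /
        (fact i * fact j * fact k * fact l * pochhammer (- of_nat N) (i + j + k + l)) *
        t ^ i * u ^ j * v ^ k * w ^ l)"
  \<comment> \<open>The expansion only reaches \<open>i + k \<le> c\<close> and
    \<open>j + l \<le> d\<close>; the further terms of the series contain a vanishing symbol of
    \<open>- of_nat c\<close> or \<open>- of_nat d\<close>.\<close>
  proof (rule sum.mono_neutral_left[OF finite_P_indices], goal_cases)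
    case 1
    show ?case
      using qcd by auto
  next
    case 2
    show ?case
    proof
      fix m assume m_in: "m \<in> {(i, j, k, l). i + j + k + l \<le> N} - ?I"
      obtain i j k l where m: "m = (i, j, k, l)"
        by (cases m)
      have "\<not> (i + k \<le> c \<and> j + l \<le> d)"
        using m_in by (simp add: m)
      then have "pochhammer (- of_nat c) (i + k) = (0 :: complex) \<or>
          pochhammer (- of_nat d) (j + l) = (0 :: complex)"
        by (metis linorder_not_le pochhammer_of_nat_eq_0_lemma)
      then show "(case m of (i, j, k, l) \<Rightarrow>
        pochhammer (- of_nat a) (i + j) * pochhammer (- of_nat b) (k + l) *
        pochhammer (- of_nat c) (i + k) * pochhammer (- of_nat d) (j + l) /
        (fact i * fact j * fact k * fact l * pochhammer (- of_nat N) (i + j + k + l)) *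
        t ^ i * u ^ j * v ^ k * w ^ l) = 0"
        unfolding m case_prod_conv
        by (elim disjE) (simp_all only: mult_zero_left mult_zero_right div_0)
    qed
  qed
  finally show ?thesis .
qed

section \<open>The bilinear form as coefficient extraction\<close>

lemma mult_in_V:
  assumes "f \<in> V m" "g \<in> V n"
  shows "f * g \<in> V (m + n)"
  using assms keys_mult[of f g] by (fastforce simp: V_def)

lemma power_in_V: "f \<in> V m \<Longrightarrow> f ^ n \<in> V (n * m)"
  by (induction n) (simp_all add: mult_in_V, simp add: V_def zero_prod_def)

lemma linear_form_in_V: "linear_form e0 e1 e2 \<in> V 1"
  by (auto intro!: add_in_V scl_in_V single_in_V simp: X_def Y_def Z_def)

text \<open>By orthogonality only the matching monomial of \<open>g\<close> contributes.\<close>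

lemma is_the_form_monomial_left:
  assumes B: "is_the_form p1 p2 p3 p4 N B" and g: "g \<in> V N" and deg: "r + s + t = N"
  shows "B (X ^ r * Y ^ s * Z ^ t) g =
    mono_norm p1 p2 p3 p4 N r s t * Poly_Mapping.lookup g (r, s, t)"
proof -
  let ?m = "X ^ r * Y ^ s * Z ^ t"
  have mV: "X ^ r * Y ^ s * Z ^ t \<in> V N" if "r + s + t = N" for r s t
    using that by (simp add: monomial single_in_V)
  have sym: "B f h = B h f"
    and additive: "B (f + f') h = B f h + B f' h"
    and scl: "B (scl c f) h = c * B f h"
    if "f \<in> V N" "f' \<in> V N" "h \<in> V N" for f f' h c
    using B that unfolding is_the_form_def symmetric_bilinear_on_def by blast+
  \<comment> \<open>Linearity is given in the first argument, so \<open>g\<close> is put there for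
    the induction; symmetry restores the order at the end.\<close>
  have "B g ?m = mono_norm p1 p2 p3 p4 N r s t * Poly_Mapping.lookup g (r, s, t)"
    using g
  proof (induction rule: V_induct)
    case zero
    then show ?case
      using scl[OF zero_in_V zero_in_V mV[OF deg], of 0] by (simp add: scl_def)
  next
    case (add r' s' t' c h)
    have "B (X ^ r' * Y ^ s' * Z ^ t') ?m =
        (if (r', s', t') = (r, s, t) then mono_norm p1 p2 p3 p4 N r s t else 0)"
      using B add.hyps(1) deg unfolding is_the_form_def by auto
    then have "B (scl c (X ^ r' * Y ^ s' * Z ^ t') + h) ?m =
        c * (if (r', s', t') = (r, s, t) then mono_norm p1 p2 p3 p4 N r s t else 0) + B h ?m"
      using add.hyps deg mV by (simp add: additive scl scl_in_V)
    then show ?case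
      using add.IH by (auto simp: lookup_add lookup_scl monomial lookup_single when_def distrib_left)
  qed
  then show ?thesis
    using sym[OF mV[OF deg] zero_in_V g] by simp
qed

theorem theorem5p3:
  fixes p1 p2 p3 p4 :: complex
    and N r s t \<rho> \<sigma> \<tau> :: nat
    and B :: "poly3 \<Rightarrow> poly3 \<Rightarrow> complex"
  assumes "p1 \<noteq> 0" "p2 \<noteq> 0" "p3 \<noteq> 0" "p4 \<noteq> 0"
    and "p1 + p2 \<noteq> 0" "p1 + p3 \<noteq> 0" "p2 + p4 \<noteq> 0" "p3 + p4 \<noteq> 0"
    and "p1 + p2 + p3 + p4 \<noteq> 0" "p1 * p4 - p2 * p3 \<noteq> 0"
    and "is_the_form p1 p2 p3 p4 N B"
    and "r + s + t = N"
    and "\<rho> + \<sigma> + \<tau> = N"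
  shows "B (X ^ r * Y ^ s * Z ^ t)
           (X' p1 p2 p3 p4 ^ \<rho> * Y' p1 p2 p3 p4 ^ \<sigma> * Z' p1 p2 p3 p4 ^ \<tau>)
         = fact N * nu p1 p2 p3 p4 ^ N
             * P p1 p2 p3 p4 N (of_nat s) (of_nat t) (of_nat \<sigma>) (of_nat \<tau>)"
proof -
  define e0 e1 e2 where "e0 = eta0' p1 p2 p3 p4" and "e1 = eta1' p1 p2 p3 p4"
    and "e2 = eta2' p1 p2 p3 p4"
  define h where "h = vtheta' p1 p2 p3 p4"
  let ?t = "bold_t p1 p2 p3 p4" and ?u = "bold_u p1 p2 p3 p4"
  let ?v = "bold_v p1 p2 p3 p4" and ?w = "bold_w p1 p2 p3 p4"
  let ?F = "linear_form e0 e1 e2 ^ \<rho> * linear_form e0 ((1 - ?t) * e1) ((1 - ?v) * e2) ^ \<sigma> *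
       linear_form e0 ((1 - ?u) * e1) ((1 - ?w) * e2) ^ \<tau>"
  have e: "e0 \<noteq> 0" "e1 \<noteq> 0" "e2 \<noteq> 0"
    using assms(1-10)
    by (simp_all add: e0_def e1_def e2_def eta0'_def eta1'_def eta2'_def nu_def psum_def)
  have "p2 * p3 - p1 * p4 \<noteq> 0"
    using assms(10) by auto
  \<comment> \<open>The denominators here and in \<open>nu\<close> differ in sign before
    squaring.\<close>
  then have nu: "vtheta p1 p2 p3 p4 * h = nu p1 p2 p3 p4"
    by (simp add: h_def vtheta_def vtheta'_def nu_def power2_commute[of "p1 * p4"])
      (simp add: power2_eq_square mult_ac)
  have scl_pow: "scl h f ^ n = scl (h ^ n) (f ^ n)" for f n
    by (simp add: scl_def power_mult_distrib single_power[of 0 0 0, simplified, folded zero_prod_def])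
  have prod: "X' p1 p2 p3 p4 ^ \<rho> * Y' p1 p2 p3 p4 ^ \<sigma> * Z' p1 p2 p3 p4 ^ \<tau> = scl (h ^ N) ?F"
  proof -
    have "cst (h ^ N) = cst (h ^ \<rho>) * cst (h ^ \<sigma>) * cst (h ^ \<tau>)"
      by (simp add: mult_single power_add assms(13)[symmetric])
    then show ?thesis
      unfolding X'_def Y'_def Z'_def e0_def[symmetric] e1_def[symmetric] e2_def[symmetric]
        h_def[symmetric] scl_pow
      by (simp add: scl_def mult_ac)
  qed
  \<comment> \<open>Homogeneity must be verified because \<open>B\<close> is constrained only on
    \<open>V N\<close>.\<close>
  have "?F \<in> V (\<rho> * 1 + \<sigma> * 1 + \<tau> * 1)"
    by (intro mult_in_V power_in_V linear_form_in_V)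
  then have "?F \<in> V N"
    using assms(13) by simp
  then have "B (X ^ r * Y ^ s * Z ^ t) (scl (h ^ N) ?F) =
      mono_norm p1 p2 p3 p4 N r s t * (h ^ N * Poly_Mapping.lookup ?F (r, s, t))"
    by (simp add: is_the_form_monomial_left[OF assms(11) _ assms(12)] scl_in_V lookup_scl)
  \<comment> \<open>The norm supplies both the factorials that the coefficient formula expects and
    the denominator that cancels its power product.\<close>
  also have "\<dots> = (vtheta p1 p2 p3 p4 * h) ^ N / (e0 ^ r * e1 ^ s * e2 ^ t) *
      (fact r * fact s * fact t * Poly_Mapping.lookup ?F (r, s, t))"
    by (simp add: mono_norm_def e0_def e1_def e2_def power_mult_distrib)
  also have "\<dots> = fact N * nu p1 p2 p3 p4 ^ N
             * P p1 p2 p3 p4 N (of_nat s) (of_nat t) (of_nat \<sigma>) (of_nat \<tau>)"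
    unfolding lookup_product_of_powers[OF assms(12,13)] nu P_def using e by simp
  finally show ?thesis
    unfolding prod .
qed

end
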